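(* Let $G=(V\cup E,\varepsilon)$ be a connected bipartite graph. Then its interior polynomial $I_G(x)$ is interpolating, i.e. the set of indices $i$ such that the coefficient of $x^i$ in $I_G(x)$ is non-zero is an integer interval $[n_1,n_2]$ (all integers from $n_1$ to $n_2$, inclusive).
   Context: $G=(V\cup E,\varepsilon)$ denotes a finite simple bipartite graph with non-empty colour classes $V$ and $E$ and edge set $\varepsilon$; the elements of $E$ are called hyperedges. For connected $G$, a hypertree of $G$ is a function $f:E\to\{0,1,2,\dots\}$ for which there is a spanning tree $\tau$ of $G$ with $d_\tau(e)=f(e)+1$ for every $e\in E$. For distinct $e,e'\in E$, we say that $e$ can transfer valence to $e'$ with respect to a hypertree $f$ if the function obtained from $f$ by decreasing $f(e)$ by 1 and increasing $f(e')$ by 1 is also a hypertree. Fix a total order on $E$. A hyperedge $e$ is internally inactive with respect to $f$ if there is $e'<e$ such that $e$ can transfer valence to $e'$ with respect to $f$; otherwise it is internally active. Let $\overline{\iota}(f)$ be the number of internally inactive hyperedges. The interior polynomial is $I_G(x)=\sum_f x^{\overline{\iota}(f)}$, the sum being over all hypertrees $f$ of $G$. It is known that $I_G$ does not depend on the order on $E$, nor on which of the two colour classes is taken as the set of hyperedges. *)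

theory Defs
  imports "HOL-Library.FuncSet" "HOL-Computational_Algebra.Polynomial"
begin

text \<open>
  An undirected simple graph is given by its vertex set \<open>W\<close> and its set \<open>F\<close> of edges, each edge
  being a two-element subset of \<open>W\<close>.  (The notion of tree in the AFP entry Graph_Theory refers to
  directed cycles and is therefore not the undirected one.)
\<close>

definition walk :: "'a set \<Rightarrow> 'a set set \<Rightarrow> 'a list \<Rightarrow> bool" where
  "walk W F p \<longleftrightarrow> p \<noteq> [] \<and> set p \<subseteq> W \<and> (\<forall>i. Suc i < length p \<longrightarrow> {p ! i, p ! Suc i} \<in> F)"

definition connected_graph :: "'a set \<Rightarrow> 'a set set \<Rightarrow> bool" where
  "connected_graph W F \<longleftrightarrow>
    W \<noteq> {} \<and> (\<forall>u\<in>W. \<forall>w\<in>W. \<exists>p. walk W F p \<and> hd p = u \<and> last p = w)"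

text \<open>A cycle is listed by its vertices, without repeating the starting point at the end.\<close>

definition cycle :: "'a set \<Rightarrow> 'a set set \<Rightarrow> 'a list \<Rightarrow> bool" where
  "cycle W F p \<longleftrightarrow> walk W F p \<and> distinct p \<and> 3 \<le> length p \<and> {last p, hd p} \<in> F"

definition tree :: "'a set \<Rightarrow> 'a set set \<Rightarrow> bool" where
  "tree W F \<longleftrightarrow> connected_graph W F \<and> \<not> (\<exists>p. cycle W F p)"

text \<open>A spanning tree has vertex set \<open>W\<close>, so it is identified with its edge set \<open>T\<close>.\<close>

definition spanning_tree :: "'a set \<Rightarrow> 'a set set \<Rightarrow> 'a set set \<Rightarrow> bool" where
  "spanning_tree W F T \<longleftrightarrow> T \<subseteq> F \<and> tree W T"

definition degree_in :: "'a set set \<Rightarrow> 'a \<Rightarrow> nat" where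
  "degree_in F x = card {t \<in> F. x \<in> t}"

definition bipartite_graph :: "'a set \<Rightarrow> 'a set \<Rightarrow> 'a set set \<Rightarrow> bool" where
  "bipartite_graph V E \<epsilon> \<longleftrightarrow>
    finite V \<and> finite E \<and> V \<noteq> {} \<and> E \<noteq> {} \<and> V \<inter> E = {} \<and>
    \<epsilon> \<subseteq> {{v, e} | v e. v \<in> V \<and> e \<in> E}"

text \<open>
  Functions from \<open>E\<close> to the natural numbers are represented extensionally (they are
  \<open>undefined\<close> outside \<open>E\<close>), so that each hypertree is counted exactly once.
\<close>

definition hypertree :: "'a set \<Rightarrow> 'a set \<Rightarrow> 'a set set \<Rightarrow> ('a \<Rightarrow> nat) \<Rightarrow> bool" where
  "hypertree V E \<epsilon> f \<longleftrightarrow>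
    f \<in> E \<rightarrow>\<^sub>E UNIV \<and> (\<exists>T. spanning_tree (V \<union> E) \<epsilon> T \<and> (\<forall>e\<in>E. degree_in T e = f e + 1))"

text \<open>
  The condition \<open>0 < f e\<close> excludes the truncating case of subtraction: decreasing the value 0
  does not give a function into the natural numbers.
\<close>

definition can_transfer ::
    "'a set \<Rightarrow> 'a set \<Rightarrow> 'a set set \<Rightarrow> ('a \<Rightarrow> nat) \<Rightarrow> 'a \<Rightarrow> 'a \<Rightarrow> bool" where
  "can_transfer V E \<epsilon> f e e' \<longleftrightarrow>
    e \<in> E \<and> e' \<in> E \<and> e \<noteq> e' \<and> 0 < f e \<and>
    hypertree V E \<epsilon> (f(e := f e - 1, e' := f e' + 1))"

text \<open>The relation \<open>r\<close> is the reflexive version of the total order on \<open>E\<close>.\<close>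

definition internally_inactive ::
    "'a set \<Rightarrow> 'a set \<Rightarrow> 'a set set \<Rightarrow> 'a rel \<Rightarrow> ('a \<Rightarrow> nat) \<Rightarrow> 'a \<Rightarrow> bool" where
  "internally_inactive V E \<epsilon> r f e \<longleftrightarrow>
    (\<exists>e'\<in>E. (e', e) \<in> r \<and> e' \<noteq> e \<and> can_transfer V E \<epsilon> f e e')"

definition internal_inactivity ::
    "'a set \<Rightarrow> 'a set \<Rightarrow> 'a set set \<Rightarrow> 'a rel \<Rightarrow> ('a \<Rightarrow> nat) \<Rightarrow> nat" where
  "internal_inactivity V E \<epsilon> r f = card {e \<in> E. internally_inactive V E \<epsilon> r f e}"

definition interior_polynomial ::
    "'a set \<Rightarrow> 'a set \<Rightarrow> 'a set set \<Rightarrow> 'a rel \<Rightarrow> int poly" where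
  "interior_polynomial V E \<epsilon> r =
    (\<Sum>f | hypertree V E \<epsilon> f. monom 1 (internal_inactivity V E \<epsilon> r f))"

text \<open>The sum above ranges over a finite set.\<close>

lemma finite_hypertrees:
  assumes "bipartite_graph V E \<epsilon>"
  shows "finite {f. hypertree V E \<epsilon> f}"
proof -
  have "\<epsilon> \<subseteq> (\<lambda>(v, e). {v, e}) ` (V \<times> E)" "finite (V \<times> E)"
    using assms by (auto simp: bipartite_graph_def)
  then have "finite \<epsilon>"
    using finite_surj by blast
  moreover have "{f. hypertree V E \<epsilon> f} \<subseteq> (\<lambda>T. restrict (\<lambda>e. degree_in T e - 1) E) ` Pow \<epsilon>"
  proof
    fix f assume "f \<in> {f. hypertree V E \<epsilon> f}"
    then obtain T where f: "f \<in> extensional E" and "T \<subseteq> \<epsilon>" "\<forall>e\<in>E. degree_in T e = f e + 1"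
      by (auto simp: hypertree_def spanning_tree_def PiE_def)
    moreover from this have "f = restrict (\<lambda>e. degree_in T e - 1) E"
      by (intro extensionalityI[OF f]) auto
    ultimately show "f \<in> (\<lambda>T. restrict (\<lambda>e. degree_in T e - 1) E) ` Pow \<epsilon>"
      by blast
  qed
  ultimately show ?thesis
    by (meson finite_Pow_iff finite_surj)
qed

definition interpolating :: "'a::zero poly \<Rightarrow> bool" where
  "interpolating p \<longleftrightarrow> (\<exists>n\<^sub>1 n\<^sub>2. n\<^sub>1 \<le> n\<^sub>2 \<and> {i. coeff p i \<noteq> 0} = {n\<^sub>1..n\<^sub>2})"

end

theory Submission
  imports Defs
begin

text \<open>
  Only the exchange property of hypertrees matters: if \<open>g e < f e\<close>, then \<open>e\<close> can transfer valence
  with respect to \<open>f\<close> to some \<open>e'\<close> with \<open>f e' < g e'\<close>.  Let \<open>n\<close> be the largest hyperedge and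
  slice the set of hypertrees according to the value \<open>f n\<close>.  Each slice again has the exchange
  property, and the activity of the other hyperedges can be computed inside the slice; by exchange,
  \<open>n\<close> is active exactly on the slice of the smallest value.  By induction on the number of
  hyperedges the inactivities on each slice form an interval starting at \<open>0\<close>.  The intervals of the
  slices other than the lowest are shifted by one, and the union is again an interval starting
  at \<open>0\<close>.

  The exchange property is obtained by moving a spanning tree for \<open>f\<close> towards one for \<open>g\<close> with
  single edge exchanges, always removing an edge at the hyperedge that gained one last.
\<close>

section \<open>Inactivity in sets with the exchange property\<close>

text \<open>The one-sided exchange axiom of M-convex sets: only \<open>f\<close> is modified. The
  coordinates \<open>A\<close> are kept apart from the functions, so that fixing a coordinate does
  not require restricting them.\<close>

definition exchange_on :: "'a set \<Rightarrow> ('a \<Rightarrow> nat) set \<Rightarrow> bool" where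
  "exchange_on A B \<longleftrightarrow> (\<forall>f\<in>B. \<forall>g\<in>B. \<forall>e\<in>A. g e < f e \<longrightarrow>
     (\<exists>e'\<in>A. f e' < g e' \<and> f(e := f e - 1, e' := f e' + 1) \<in> B))"

text \<open>Internal inactivity with an arbitrary \<open>B\<close> in place of the hypertrees and
  with transfers confined to \<open>A\<close>, so that an induction can pass to slices.\<close>

definition inactive_set :: "'a rel \<Rightarrow> 'a set \<Rightarrow> ('a \<Rightarrow> nat) set \<Rightarrow> ('a \<Rightarrow> nat) \<Rightarrow> 'a set" where
  "inactive_set r A B f =
     {e \<in> A. \<exists>e'\<in>A. (e', e) \<in> r \<and> e' \<noteq> e \<and> 0 < f e \<and> f(e := f e - 1, e' := f e' + 1) \<in> B}"

text \<open>\<open>f\<close> and \<open>g\<close> agree at \<open>n\<close>, so the strict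
  inequalities keep both \<open>e\<close> and \<open>e'\<close> away from \<open>n\<close>.\<close>

lemma exchange_on_slice:
  assumes "exchange_on (insert n A) B"
  shows "exchange_on A {f \<in> B. f n = j}"
  unfolding exchange_on_def
proof (intro ballI impI)
  fix f g e
  assume f: "f \<in> {f \<in> B. f n = j}" and g: "g \<in> {f \<in> B. f n = j}" and "e \<in> A" and less: "g e < f e"
  then obtain e' where "e' \<in> insert n A" "f e' < g e'" "f(e := f e - 1, e' := f e' + 1) \<in> B"
    using assms unfolding exchange_on_def by blast
  moreover have "e \<noteq> n" "e' \<noteq> n"
    using f g less \<open>f e' < g e'\<close> by auto
  ultimately show "\<exists>e'\<in>A. f e' < g e' \<and> f(e := f e - 1, e' := f e' + 1) \<in> {f \<in> B. f n = j}"
    using f by (intro bexI[of _ e']) auto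
qed

text \<open>For an element of \<open>A\<close> the larger \<open>n\<close> does not count as a
  target, and transfers inside \<open>A\<close> preserve the value at \<open>n\<close>. A transfer
  from \<open>n\<close> lowers that value; conversely, exchange against the minimizer
  \<open>h\<close> yields one whenever \<open>h n < f n\<close>.\<close>

lemma inactive_set_insert_max:
  assumes "antisym r" and "n \<notin> A" and max: "\<And>x. x \<in> A \<Longrightarrow> (x, n) \<in> r"
    and exch: "exchange_on (insert n A) B"
    and h: "h \<in> B" "\<And>g. g \<in> B \<Longrightarrow> h n \<le> g n" and f: "f \<in> B"
  shows "inactive_set r (insert n A) B f =
    inactive_set r A {g \<in> B. g n = f n} f \<union> (if h n < f n then {n} else {})"
proof -
  have "e \<in> inactive_set r (insert n A) B f \<longleftrightarrow> e \<in> inactive_set r A {g \<in> B. g n = f n} f"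
    if "e \<in> A" for e
  proof -
    have "(n, e) \<notin> r"
      using that \<open>antisym r\<close> \<open>n \<notin> A\<close> max[of e] by (auto dest: antisymD)
    moreover have "n \<noteq> e'" if "e' \<in> A" for e'
      using that \<open>n \<notin> A\<close> by blast
    ultimately show ?thesis
      using that \<open>n \<notin> A\<close> unfolding inactive_set_def by (simp cong: bex_cong)
  qed
  moreover have "n \<in> inactive_set r (insert n A) B f \<longleftrightarrow> h n < f n"
  proof
    assume "n \<in> inactive_set r (insert n A) B f"
    then obtain e' where "e' \<noteq> n" "0 < f n" "f(n := f n - 1, e' := f e' + 1) \<in> B"
      by (auto simp: inactive_set_def)
    with h(2)[OF this(3)] show "h n < f n"
      by auto
  next
    assume less: "h n < f n"
    then obtain e' where "e' \<in> insert n A" "f e' < h e'" "f(n := f n - 1, e' := f e' + 1) \<in> B"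
      using exch f h(1) unfolding exchange_on_def by blast
    with less max show "n \<in> inactive_set r (insert n A) B f"
      by (auto simp: inactive_set_def intro!: bexI[of _ e'])
  qed
  moreover have "inactive_set r A C f \<subseteq> A" "inactive_set r (insert n A) C f \<subseteq> insert n A" for C
    by (auto simp: inactive_set_def)
  ultimately show ?thesis
    using \<open>n \<notin> A\<close> by (cases "h n < f n") (simp_all, blast+)
qed

text \<open>Downward closure encodes an interval starting at 0 and spares a union of intervals:
  \<open>k = 0\<close> is realized in the lowest slice, a positive \<open>k\<close> in the slice of
  \<open>f\<close> itself.\<close>

lemma inactivities_downward_closed:
  assumes "finite A" and "linear_order_on E r" and "A \<subseteq> E" and "exchange_on A B"
    and "f \<in> B" and "k \<le> card (inactive_set r A B f)"
  shows "\<exists>g\<in>B. card (inactive_set r A B g) = k"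
  using assms
proof (induction "card A" arbitrary: A B f k)
  case 0
  then show ?case
    by (auto simp: inactive_set_def)
next
  case (Suc m)
  have r: "antisym r" "trans r" "total_on E r"
    using Suc.prems(2) by (auto simp: linear_order_on_def partial_order_on_def preorder_on_def)
  have "A \<noteq> {}"
    using Suc.hyps(2) by auto
  then obtain n where n: "n \<in> A" "\<forall>x\<in>A. x \<noteq> n \<longrightarrow> \<not> ((n, x) \<in> r \<and> n \<noteq> x)"
    using Finite_Set.bex_max_element[of A "\<lambda>x y. (x, y) \<in> r \<and> x \<noteq> y"] Suc.prems(1) r(1,2)
    by (fastforce simp: asymp_on_def transp_on_def dest: antisymD transD)
  define A' where "A' = A - {n}"
  have A: "A = insert n A'" "n \<notin> A'"
    using n by (auto simp: A'_def)
  have card: "m = card A'" "finite A'" "A' \<subseteq> E"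
    using Suc.hyps(2) Suc.prems(1,3) by (auto simp: A)
  have max: "(x, n) \<in> r" if "x \<in> A'" for x
    using that n r(3) Suc.prems(3) unfolding total_on_def A'_def by blast
  obtain h where h: "h \<in> B" "\<And>g. g \<in> B \<Longrightarrow> h n \<le> g n"
    using ex_has_least_nat[of "\<lambda>g. g \<in> B" f "\<lambda>g. g n"] Suc.prems(5) by blast
  have ia: "card (inactive_set r A B g) =
      card (inactive_set r A' {g' \<in> B. g' n = g n} g) + (if h n < g n then 1 else 0)"
    if "g \<in> B" for g
  proof -
    have "inactive_set r A' C g \<subseteq> A'" for C
      by (auto simp: inactive_set_def)
    then have "finite (inactive_set r A' C g)" "n \<notin> inactive_set r A' C g" for C
      using A card(2) finite_subset by blast+
    moreover have "inactive_set r A B g =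
        inactive_set r A' {g' \<in> B. g' n = g n} g \<union> (if h n < g n then {n} else {})"
      unfolding A(1) by (rule inactive_set_insert_max)
        (use r(1) A(2) max Suc.prems(4)[unfolded A(1)] h that in simp_all)
    ultimately show ?thesis
      by simp
  qed
  have slice: "\<exists>g'\<in>B. g' n = g n \<and> card (inactive_set r A' {g' \<in> B. g' n = g n} g') = l"
    if "g \<in> B" "l \<le> card (inactive_set r A' {g' \<in> B. g' n = g n} g)" for g l
    using Suc.hyps(1)[OF card(1,2) Suc.prems(2) card(3) exchange_on_slice, of n B g "g n" l]
      Suc.prems(4) that by (auto simp: A(1))
  show ?case
  proof (cases "k = 0")
    case True
    from slice[OF h(1), of 0] obtain g where
      "g \<in> B" "g n = h n" "card (inactive_set r A' {g' \<in> B. g' n = h n} g) = 0"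
      by auto
    with True show ?thesis
      by (intro bexI[of _ g]) (simp_all add: ia)
  next
    case False
    \<comment> \<open>The contribution of \<open>n\<close>, constant on the slice of
      \<open>f\<close>. As \<open>k\<close> is positive, \<open>k - d\<close> does not
      truncate.\<close>
    define d :: nat where "d = (if h n < f n then 1 else 0)"
    have "k - d \<le> card (inactive_set r A' {g' \<in> B. g' n = f n} f)"
      using Suc.prems(6) ia[OF Suc.prems(5)] by (simp add: d_def)
    from slice[OF Suc.prems(5) this] obtain g where
      g: "g \<in> B" "g n = f n" "card (inactive_set r A' {g' \<in> B. g' n = f n} g) = k - d"
      by blast
    then have "card (inactive_set r A B g) = k"
      using ia[OF g(1)] False by (simp add: d_def split: if_splits)
    with g(1) show ?thesis
      by blast
  qed
qed

section \<open>Edge exchange for spanning trees\<close>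

definition adjacency :: "'a set set \<Rightarrow> 'a rel" where
  "adjacency F = {(u, v). {u, v} \<in> F}"

lemma adjacency_iff [simp]: "(u, v) \<in> adjacency F \<longleftrightarrow> {u, v} \<in> F"
  by (simp add: adjacency_def)

lemma adjacency_rtrancl_mono:
  "(u, v) \<in> (adjacency F)\<^sup>* \<Longrightarrow> F \<subseteq> G \<Longrightarrow> (u, v) \<in> (adjacency G)\<^sup>*"
  by (rule rtrancl_mono[THEN subsetD, rotated]) auto

lemma adjacency_rtrancl_sym: "(u, v) \<in> (adjacency F)\<^sup>* \<Longrightarrow> (v, u) \<in> (adjacency F)\<^sup>*"
  using sym_rtrancl[of "adjacency F"] by (auto simp: sym_def insert_commute)

text \<open>A path can be shortened to use the new edge at most once, in one of its two
  directions.\<close>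

lemma adjacency_rtrancl_insert:
  assumes "(p, q) \<in> (adjacency (insert {x, y} F))\<^sup>*"
  shows "(p, q) \<in> (adjacency F)\<^sup>* \<or>
    (p, x) \<in> (adjacency F)\<^sup>* \<and> (y, q) \<in> (adjacency F)\<^sup>* \<or>
    (p, y) \<in> (adjacency F)\<^sup>* \<and> (x, q) \<in> (adjacency F)\<^sup>*"
  using assms
proof (induction rule: rtrancl_induct)
  case base
  then show ?case by simp
next
  case (step q s)
  show ?case
  proof (cases "{q, s} \<in> F")
    case True
    then have "(z, s) \<in> (adjacency F)\<^sup>*" if "(z, q) \<in> (adjacency F)\<^sup>*" for z
      using that by (meson adjacency_iff rtrancl.rtrancl_into_rtrancl)
    with step.IH show ?thesis by blast
  next
    case False
    with step.hyps(2) have "q = x \<and> s = y \<or> q = y \<and> s = x"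
      by (auto simp: doubleton_eq_iff)
    with step.IH show ?thesis by auto
  qed
qed

lemma walk_rtrancl:
  assumes "walk W F p"
  shows "(hd p, last p) \<in> (adjacency F)\<^sup>*"
proof -
  have "i < length p \<Longrightarrow> (p ! 0, p ! i) \<in> (adjacency F)\<^sup>*" for i
  proof (induction i)
    case (Suc i)
    then have "(p ! 0, p ! i) \<in> (adjacency F)\<^sup>*" "(p ! i, p ! Suc i) \<in> adjacency F"
      using assms by (auto simp: walk_def)
    then show ?case
      by (rule rtrancl.rtrancl_into_rtrancl)
  qed simp
  then show ?thesis
    using assms by (simp add: walk_def hd_conv_nth last_conv_nth)
qed

text \<open>Induction on the last step: if the new vertex already lies on the path, the path is cut
  there; otherwise the vertex is appended.\<close>

lemma rtrancl_distinct_walk: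
  assumes "(u, v) \<in> (adjacency F)\<^sup>*" and "u \<in> W" and "\<Union>F \<subseteq> W"
  shows "\<exists>p. walk W F p \<and> hd p = u \<and> last p = v \<and> distinct p"
  using assms(1)
proof (induction rule: rtrancl_induct)
  case base
  then show ?case
    using assms(2) by (intro exI[of _ "[u]"]) (auto simp: walk_def)
next
  case (step v w)
  then obtain p where p: "walk W F p" "hd p = u" "last p = v" "distinct p"
    by blast
  show ?case
  proof (cases "w \<in> set p")
    case True
    then obtain i where i: "i < length p" "p ! i = w"
      by (auto simp: in_set_conv_nth)
    have "walk W F (take (Suc i) p)"
      using p(1) i(1) by (auto simp: walk_def dest: in_set_takeD)
    moreover have "last (take (Suc i) p) = w"
      using i by (simp add: take_Suc_conv_app_nth)
    moreover have "hd (take (Suc i) p) = u" "distinct (take (Suc i) p)"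
      using p by auto
    ultimately show ?thesis by blast
  next
    case False
    have "w \<in> W"
      using step.hyps(2) assms(3) by auto
    moreover have "{(p @ [w]) ! i, (p @ [w]) ! Suc i} \<in> F" if "Suc i < length (p @ [w])" for i
    proof (cases "Suc i < length p")
      case True
      then show ?thesis
        using p(1) by (auto simp: walk_def nth_append)
    next
      case False
      with that have "Suc i = length p" by simp
      moreover from this have "p ! i = v"
        using p(1,3) by (metis diff_Suc_1 last_conv_nth walk_def)
      ultimately show ?thesis
        using step.hyps(2) by (auto simp: nth_append)
    qed
    ultimately have "walk W F (p @ [w])"
      using p(1) by (auto simp: walk_def)
    moreover have "hd (p @ [w]) = u"
      using p by (auto simp: walk_def)
    ultimately show ?thesis
      using False p(4) by (intro exI[of _ "p @ [w]"]) auto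
  qed
qed

lemma connected_graph_iff:
  assumes "\<Union>F \<subseteq> W"
  shows "connected_graph W F \<longleftrightarrow> W \<noteq> {} \<and> (\<forall>u\<in>W. \<forall>w\<in>W. (u, w) \<in> (adjacency F)\<^sup>*)"
proof -
  have "(\<exists>p. walk W F p \<and> hd p = u \<and> last p = w) \<longleftrightarrow> (u, w) \<in> (adjacency F)\<^sup>*" if "u \<in> W" for u w
    using rtrancl_distinct_walk[OF _ that assms, of w] by (auto dest: walk_rtrancl)
  then show ?thesis
    by (simp add: connected_graph_def)
qed

text \<open>A cycle without its closing edge still joins the ends of that edge; conversely, a
  repetition-free path avoiding an edge between its ends is closed up by that edge.\<close>

lemma ex_cycle_iff_ex_non_bridge:
  assumes "\<Union>F \<subseteq> W" and "\<And>t. t \<in> F \<Longrightarrow> card t = 2"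
  shows "(\<exists>p. cycle W F p) \<longleftrightarrow> (\<exists>u v. {u, v} \<in> F \<and> (u, v) \<in> (adjacency (F - {{u, v}}))\<^sup>*)"
proof
  assume "\<exists>p. cycle W F p"
  then obtain p where p: "walk W F p" "distinct p" "3 \<le> length p" "{last p, hd p} \<in> F"
    by (auto simp: cycle_def)
  have "{p ! i, p ! Suc i} \<noteq> {hd p, last p}" if "Suc i < length p" for i
  proof -
    have "p \<noteq> []" using p(3) by auto
    then have ends: "hd p = p ! 0" "last p = p ! (length p - 1)"
      by (auto simp: hd_conv_nth last_conv_nth)
    have idx: "p ! i = p ! 0 \<longleftrightarrow> i = 0" "p ! Suc i = p ! 0 \<longleftrightarrow> Suc i = 0"
      "p ! Suc i = p ! (length p - 1) \<longleftrightarrow> Suc i = length p - 1"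
      using that \<open>p \<noteq> []\<close> by (subst nth_eq_iff_index_eq[OF p(2)]; simp)+
    show ?thesis
      unfolding ends doubleton_eq_iff idx using p(3) by auto
  qed
  with p(1) have "walk W (F - {{hd p, last p}}) p"
    by (auto simp: walk_def)
  with p(4) show "\<exists>u v. {u, v} \<in> F \<and> (u, v) \<in> (adjacency (F - {{u, v}}))\<^sup>*"
    by (metis walk_rtrancl insert_commute)
next
  assume "\<exists>u v. {u, v} \<in> F \<and> (u, v) \<in> (adjacency (F - {{u, v}}))\<^sup>*"
  then obtain u v where uv: "{u, v} \<in> F" "(u, v) \<in> (adjacency (F - {{u, v}}))\<^sup>*"
    by blast
  have "u \<noteq> v"
    using assms(2)[OF uv(1)] by auto
  obtain p where p: "walk W (F - {{u, v}}) p" "hd p = u" "last p = v" "distinct p"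
    using rtrancl_distinct_walk[OF uv(2), of W] assms(1) uv(1) by auto
  \<comment> \<open>A single vertex would force \<open>u = v\<close>, and two vertices would use the
    deleted edge.\<close>
  have "3 \<le> length p"
  proof (rule ccontr)
    assume short: "\<not> 3 \<le> length p"
    obtain a q where q: "p = a # q"
      using p(1) by (cases p) (auto simp: walk_def)
    with \<open>u \<noteq> v\<close> p(2,3) obtain b q' where "q = b # q'"
      by (cases q) auto
    with q short have "p = [a, b]"
      by (cases q') auto
    with p show False
      by (auto simp: walk_def)
  qed
  moreover have "walk W F p"
    using p(1) by (auto simp: walk_def)
  ultimately have "cycle W F p"
    using p uv(1) by (auto simp: cycle_def insert_commute)
  then show "\<exists>p. cycle W F p" ..
qed

section \<open>Spanning trees of a finite simple graph\<close>

locale simple_graph =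
  fixes W :: "'a set" and F :: "'a set set"
  assumes edges_subset: "\<Union>F \<subseteq> W"
    and card_edge: "t \<in> F \<Longrightarrow> card t = 2"
    and finite_edges: "finite F"
begin

text \<open>Acyclicity becomes the condition that every edge is a bridge, so the exchange argument
  can be carried out with reachability alone.\<close>

lemma spanning_tree_iff:
  "spanning_tree W F T \<longleftrightarrow> T \<subseteq> F \<and> W \<noteq> {} \<and> (\<forall>u\<in>W. \<forall>w\<in>W. (u, w) \<in> (adjacency T)\<^sup>*) \<and>
    (\<forall>u v. {u, v} \<in> T \<longrightarrow> (u, v) \<notin> (adjacency (T - {{u, v}}))\<^sup>*)"
proof (cases "T \<subseteq> F")
  case True
  then have "\<Union>T \<subseteq> W" "\<And>t. t \<in> T \<Longrightarrow> card t = 2"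
    using edges_subset card_edge by auto
  then show ?thesis
    using True connected_graph_iff[of T W] ex_cycle_iff_ex_non_bridge[of T W]
    unfolding spanning_tree_def tree_def by blast
qed (simp add: spanning_tree_def)

text \<open>In a connecting edge set of least size every edge is a bridge, since any other edge
  could be dropped.\<close>

lemma ex_spanning_tree:
  assumes "connected_graph W F"
  shows "\<exists>T. spanning_tree W F T"
proof -
  let ?P = "\<lambda>T. T \<subseteq> F \<and> (\<forall>u\<in>W. \<forall>w\<in>W. (u, w) \<in> (adjacency T)\<^sup>*)"
  have W: "W \<noteq> {}" and "?P F"
    using assms edges_subset by (auto simp: connected_graph_iff)
  then obtain T where T: "?P T" and min: "\<And>T'. ?P T' \<Longrightarrow> card T \<le> card T'"
    using ex_has_least_nat[of ?P F card] by blast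
  have "(u, v) \<notin> (adjacency (T - {{u, v}}))\<^sup>*" if "{u, v} \<in> T" for u v
  proof
    let ?T = "T - {{u, v}}"
    assume uv: "(u, v) \<in> (adjacency ?T)\<^sup>*"
    have "(p, q) \<in> (adjacency ?T)\<^sup>*" if "p \<in> W" "q \<in> W" for p q
    proof -
      have "(p, q) \<in> (adjacency (insert {u, v} ?T))\<^sup>*"
        using T that \<open>{u, v} \<in> T\<close> by (simp add: insert_absorb)
      from adjacency_rtrancl_insert[OF this] uv adjacency_rtrancl_sym[OF uv] show ?thesis
        by (meson rtrancl_trans)
    qed
    with T have "?P ?T" by auto
    moreover have "card ?T < card T"
      using T finite_edges that by (meson card_Diff1_less finite_subset)
    ultimately show False
      using min[of ?T] by linarith
  qed
  with T W show ?thesis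
    by (auto simp: spanning_tree_iff)
qed

text \<open>Removing \<open>a\<close> splits \<open>T1\<close> into two components. The path in
  \<open>T2\<close> between the ends of \<open>a\<close> must cross from one to the other, and a
  crossing edge serves as \<open>b\<close>.\<close>

lemma spanning_tree_exchange:
  assumes T1: "spanning_tree W F T1" and T2: "spanning_tree W F T2" and a: "a \<in> T1 - T2"
  shows "\<exists>b\<in>T2 - T1. spanning_tree W F (insert b (T1 - {a}))"
proof -
  have "a \<in> F"
    using T1 a by (auto simp: spanning_tree_iff)
  then obtain u v where uv: "a = {u, v}" "u \<in> W" "v \<in> W"
    using card_edge[of a] edges_subset by (auto simp: card_2_iff)
  let ?R = "(adjacency (T1 - {a}))\<^sup>*"
  have nuv: "(u, v) \<notin> ?R"
    using T1 a unfolding uv spanning_tree_iff by blast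
  have "(u, v) \<in> (adjacency T2)\<^sup>*"
    using T2 uv by (auto simp: spanning_tree_iff)
  then have "\<exists>x y. {x, y} \<in> T2 \<and> (u, x) \<in> ?R \<and> (u, y) \<notin> ?R"
    using nuv
  proof (induction rule: rtrancl_induct)
    case (step y z)
    then show ?case by (cases "(u, y) \<in> ?R") auto
  qed simp
  then obtain x y where xy: "{x, y} \<in> T2" "(u, x) \<in> ?R" "(u, y) \<notin> ?R"
    by blast
  have nxy: "(x, y) \<notin> ?R"
    using xy by (meson rtrancl_trans)
  then have b: "{x, y} \<notin> T1"
    using xy a by auto
  let ?T = "insert {x, y} (T1 - {a})"
  let ?S = "(adjacency ?T)\<^sup>*"
  have "y \<in> W"
    using xy(1) T2 edges_subset by (auto simp: spanning_tree_iff)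
  \<comment> \<open>A path from \<open>u\<close> to \<open>y\<close> in \<open>T1\<close> has to run
    through \<open>a\<close>, so \<open>y\<close> lies on the side of \<open>v\<close>.\<close>
  have "(v, y) \<in> ?R"
  proof -
    have "(u, y) \<in> (adjacency (insert {u, v} (T1 - {a})))\<^sup>*"
      using T1 a uv \<open>y \<in> W\<close> by (simp add: spanning_tree_iff insert_absorb)
    from adjacency_rtrancl_insert[OF this] xy(3) show ?thesis
      using nuv by auto
  qed
  have RS: "(p, q) \<in> ?R \<Longrightarrow> (p, q) \<in> ?S" for p q
    by (erule adjacency_rtrancl_mono) auto
  have "(x, y) \<in> ?S" by (rule r_into_rtrancl) simp
  then have S: "(u, v) \<in> ?S"
    using RS[OF xy(2)] RS[OF \<open>(v, y) \<in> ?R\<close>] by (meson adjacency_rtrancl_sym rtrancl_trans)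
  have "(p, q) \<in> ?S" if "p \<in> W" "q \<in> W" for p q
  proof -
    have "(p, q) \<in> (adjacency (insert {u, v} (T1 - {a})))\<^sup>*"
      using T1 a uv that by (simp add: spanning_tree_iff insert_absorb)
    from adjacency_rtrancl_insert[OF this] S adjacency_rtrancl_sym[OF S] RS show ?thesis
      by (meson rtrancl_trans)
  qed
  moreover have "(p, q) \<notin> (adjacency (?T - {{p, q}}))\<^sup>*" if "{p, q} \<in> ?T" for p q
  proof
    assume pq: "(p, q) \<in> (adjacency (?T - {{p, q}}))\<^sup>*"
    show False
    proof (cases "{p, q} = {x, y}")
      case True
      with b have "?T - {{p, q}} = T1 - {a}" by auto
      with pq have pq': "(p, q) \<in> ?R" by simp
      moreover from True have "p = x \<and> q = y \<or> p = y \<and> q = x"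
        by (simp add: doubleton_eq_iff)
      ultimately show False
        using nxy adjacency_rtrancl_sym[OF pq'] by auto
    next
      case False
      \<comment> \<open>If \<open>{x, y}\<close> were needed to join \<open>p\<close> and
        \<open>q\<close> outside \<open>{p, q}\<close>, then going through \<open>{p, q}\<close>
        instead would connect \<open>x\<close> and \<open>y\<close> inside
        \<open>T1 - {a}\<close>.\<close>
      let ?U = "T1 - {a} - {{p, q}}"
      have T1pq: "{p, q} \<in> T1 - {a}" and "?T - {{p, q}} = insert {x, y} ?U"
        using that False by auto
      then have "(p, q) \<in> (adjacency (insert {x, y} ?U))\<^sup>*"
        using pq by simp
      moreover have "(p, q) \<notin> (adjacency ?U)\<^sup>*"
      proof
        assume "(p, q) \<in> (adjacency ?U)\<^sup>*"
        then have "(p, q) \<in> (adjacency (T1 - {{p, q}}))\<^sup>*"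
          by (rule adjacency_rtrancl_mono) auto
        with T1 T1pq show False
          by (auto simp: spanning_tree_iff)
      qed
      moreover have "(s, t) \<in> ?R" if "(s, t) \<in> (adjacency ?U)\<^sup>*" for s t
        using that by (rule adjacency_rtrancl_mono) auto
      moreover have "(p, q) \<in> ?R"
        using T1pq by (intro r_into_rtrancl) simp
      ultimately show False
        using nxy adjacency_rtrancl_insert[of p q x y ?U]
        by (meson adjacency_rtrancl_sym rtrancl_trans)
    qed
  qed
  moreover have "?T \<subseteq> F" "W \<noteq> {}"
    using T1 T2 xy(1) by (auto simp: spanning_tree_iff)
  ultimately have "spanning_tree W F ?T"
    unfolding spanning_tree_iff by blast
  with xy(1) b show ?thesis by blast
qed

end

section \<open>The exchange property of hypertrees\<close>

lemma simple_graph_bipartite: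
  assumes "bipartite_graph V E \<epsilon>"
  shows "simple_graph (V \<union> E) \<epsilon>"
proof
  show "\<Union>\<epsilon> \<subseteq> V \<union> E" "\<And>t. t \<in> \<epsilon> \<Longrightarrow> card t = 2"
    using assms by (fastforce simp: bipartite_graph_def card_2_iff)+
  have "\<epsilon> \<subseteq> Pow (V \<union> E)" "finite (V \<union> E)"
    using assms by (fastforce simp: bipartite_graph_def)+
  then show "finite \<epsilon>"
    by (meson finite_Pow_iff finite_subset)
qed

text \<open>The colour classes are disjoint. Hence an edge exchange takes one unit of degree from a
  single hyperedge and gives it to a single hyperedge, as a transfer of valence does.\<close>

lemma bipartite_edge_hyperedge:
  assumes "bipartite_graph V E \<epsilon>" and "t \<in> \<epsilon>"
  obtains e where "e \<in> E" "\<And>z. z \<in> E \<Longrightarrow> z \<in> t \<longleftrightarrow> z = e"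
proof -
  have "t \<in> {{v, e} | v e. v \<in> V \<and> e \<in> E}"
    using assms by (auto simp: bipartite_graph_def)
  then obtain v e where "t = {v, e}" "v \<in> V" "e \<in> E"
    by blast
  moreover have "V \<inter> E = {}"
    using assms by (simp add: bipartite_graph_def)
  ultimately show ?thesis
    by (intro that[of e]) auto
qed

lemma degree_in_insert:
  assumes "finite T" and "b \<notin> T"
  shows "degree_in (insert b T) z = degree_in T z + (if z \<in> b then 1 else 0)"
proof -
  have "{t \<in> insert b T. z \<in> t} =
      (if z \<in> b then insert b {t \<in> T. z \<in> t} else {t \<in> T. z \<in> t})"
    by auto
  then show ?thesis
    using assms by (simp add: degree_in_def)
qed

text \<open>The tree \<open>T\<close> has the degrees of the function obtained from \<open>f\<close> by a transfer from \<open>e\<close> to \<open>x\<close>;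
  the case \<open>x = e\<close> is the start, where \<open>T\<close> realizes \<open>f\<close> itself.\<close>

lemma hypertree_exchange_aux:
  assumes bip: "bipartite_graph V E \<epsilon>"
    and T2: "spanning_tree (V \<union> E) \<epsilon> T2" "\<forall>z\<in>E. degree_in T2 z = g z + 1"
    and e: "e \<in> E" "g e < f e"
    and T: "spanning_tree (V \<union> E) \<epsilon> T" and x: "x \<in> E"
    and deg: "\<forall>z\<in>E. degree_in T z + (if z = e then 1 else 0) = f z + 1 + (if z = x then 1 else 0)"
  shows "\<exists>x\<in>E. f x < g x \<and> (\<exists>T. spanning_tree (V \<union> E) \<epsilon> T \<and>
    (\<forall>z\<in>E. degree_in T z + (if z = e then 1 else 0) = f z + 1 + (if z = x then 1 else 0)))"
  using T x deg
\<comment> \<open>Each exchange trades an edge outside \<open>T2\<close> for one inside it, which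
  decreases this measure.\<close>
proof (induction "card (T - T2)" arbitrary: T x rule: less_induct)
  case less
  interpret simple_graph "V \<union> E" \<epsilon>
    using bip by (rule simple_graph_bipartite)
  show ?case
  proof (cases "f x < g x")
    case True
    with less.prems show ?thesis by blast
  next
    case False
    have sub: "T \<subseteq> \<epsilon>" "T2 \<subseteq> \<epsilon>"
      using less.prems(1) T2(1) by (auto simp: spanning_tree_def)
    then have fin: "finite T" "finite T2"
      using finite_edges finite_subset by blast+
    \<comment> \<open>For \<open>x = e\<close> this is \<open>g e + 1 < f e + 1\<close>; otherwise
      \<open>T\<close> has degree \<open>f x + 2\<close> at \<open>x\<close>, and
      \<open>g x \<le> f x\<close>.\<close>
    have "degree_in T2 x < degree_in T x"
      using bspec[OF less.prems(3,2)] bspec[OF T2(2) less.prems(2)] e(2) False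
      by (cases "x = e") auto
    then have "\<not> {t \<in> T. x \<in> t} \<subseteq> {t \<in> T2. x \<in> t}"
      using card_mono[of "{t \<in> T2. x \<in> t}" "{t \<in> T. x \<in> t}"] fin
      by (auto simp: degree_in_def)
    then obtain a where a: "a \<in> T - T2" "x \<in> a"
      by auto
    obtain b where b: "b \<in> T2 - T" "spanning_tree (V \<union> E) \<epsilon> (insert b (T - {a}))"
      using spanning_tree_exchange[OF less.prems(1) T2(1) a(1)] by blast
    obtain y where y: "y \<in> E" "\<And>z. z \<in> E \<Longrightarrow> z \<in> b \<longleftrightarrow> z = y"
      using bipartite_edge_hyperedge[OF bip] b(1) sub(2) by blast
    obtain x' where "\<And>z. z \<in> E \<Longrightarrow> z \<in> a \<longleftrightarrow> z = x'"
      using bipartite_edge_hyperedge[OF bip] a(1) sub(1) by blast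
    with a(2) less.prems(2) have ax: "z \<in> a \<longleftrightarrow> z = x" if "z \<in> E" for z
      using that by simp
    have "insert b (T - {a}) - T2 \<subset> T - T2"
      using a(1) b(1) by auto
    then have "card (insert b (T - {a}) - T2) < card (T - T2)"
      using fin by (intro psubset_card_mono) auto
    \<comment> \<open>The extra unit moves from \<open>x\<close> to \<open>y\<close>; the case
      \<open>y = e\<close> leads back to the degrees of \<open>f\<close>.\<close>
    moreover have "degree_in (insert b (T - {a})) z + (if z = e then 1 else 0) =
        f z + 1 + (if z = y then 1 else 0)" if "z \<in> E" for z
    proof -
      have "degree_in T z = degree_in (T - {a}) z + (if z = x then 1 else 0)"
        using degree_in_insert[of "T - {a}" a z] fin a(1) ax[OF that] by (simp add: insert_absorb)
      moreover have "degree_in (insert b (T - {a})) z =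
          degree_in (T - {a}) z + (if z = y then 1 else 0)"
        using degree_in_insert[of "T - {a}" b z] fin b(1) y(2)[OF that] by simp
      ultimately show ?thesis
        using less.prems(3) that by fastforce
    qed
    ultimately show ?thesis
      using less.hyps[OF _ b(2) y(1)] by blast
  qed
qed

text \<open>The search starts at \<open>x = e\<close>, where the two corrections cancel. Its result
  satisfies \<open>f x < g x\<close>, which rules out \<open>x = e\<close>.\<close>

lemma exchange_on_hypertrees:
  assumes "bipartite_graph V E \<epsilon>"
  shows "exchange_on E {f. hypertree V E \<epsilon> f}"
  unfolding exchange_on_def
proof (intro ballI impI)
  fix f g e
  assume "f \<in> {f. hypertree V E \<epsilon> f}" "g \<in> {f. hypertree V E \<epsilon> f}" and e: "e \<in> E" "g e < f e"
  then obtain T1 T2 where f: "f \<in> extensional E"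
    and T1: "spanning_tree (V \<union> E) \<epsilon> T1" "\<forall>z\<in>E. degree_in T1 z = f z + 1"
    and T2: "spanning_tree (V \<union> E) \<epsilon> T2" "\<forall>z\<in>E. degree_in T2 z = g z + 1"
    by (auto simp: hypertree_def PiE_def)
  have "\<forall>z\<in>E. degree_in T1 z + (if z = e then 1 else 0) = f z + 1 + (if z = e then 1 else 0)"
    using T1(2) by simp
  from hypertree_exchange_aux[where f = f and g = g and e = e and x = e,
      OF assms T2 e T1(1) e(1) this]
  obtain x T where x: "x \<in> E" "f x < g x" and T: "spanning_tree (V \<union> E) \<epsilon> T"
    and deg: "\<forall>z\<in>E. degree_in T z + (if z = e then 1 else 0) = f z + 1 + (if z = x then 1 else 0)"
    by blast
  let ?f = "f(e := f e - 1, x := f x + 1)"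
  have "x \<noteq> e"
    using x e by auto
  have "degree_in T z = ?f z + 1" if "z \<in> E" for z
    using bspec[OF deg that] \<open>x \<noteq> e\<close> e by (cases "z = e"; cases "z = x") auto
  moreover have "?f \<in> extensional E"
    using f x(1) e(1) by (auto simp: extensional_def)
  ultimately have "hypertree V E \<epsilon> ?f"
    using T by (auto simp: hypertree_def PiE_def)
  with x show "\<exists>e'\<in>E. f e' < g e' \<and> f(e := f e - 1, e' := f e' + 1) \<in> {f. hypertree V E \<epsilon> f}"
    by blast
qed

section \<open>Existence of hypertrees and the support of the polynomial\<close>

lemma ex_hypertree:
  assumes bip: "bipartite_graph V E \<epsilon>" and con: "connected_graph (V \<union> E) \<epsilon>"
  shows "\<exists>f. hypertree V E \<epsilon> f"
proof -
  interpret simple_graph "V \<union> E" \<epsilon>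
    using bip by (rule simple_graph_bipartite)
  obtain T where T: "spanning_tree (V \<union> E) \<epsilon> T"
    using ex_spanning_tree[OF con] by blast
  then have "finite T"
    using finite_edges finite_subset by (auto simp: spanning_tree_def)
  obtain v where v: "v \<in> V"
    using bip by (auto simp: bipartite_graph_def)
  \<comment> \<open>Each hyperedge must be joined to \<open>v\<close> in the tree, so subtracting 1
    from its degree does not truncate.\<close>
  have "0 < degree_in T e" if "e \<in> E" for e
  proof -
    have "(e, v) \<in> (adjacency T)\<^sup>*" "e \<noteq> v"
      using T v that bip by (auto simp: spanning_tree_iff bipartite_graph_def)
    then obtain w where "{e, w} \<in> T"
      by (metis adjacency_iff converse_rtranclE)
    then show ?thesis
      using \<open>finite T\<close> by (auto simp: degree_in_def card_gt_0_iff)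
  qed
  then have "hypertree V E \<epsilon> (restrict (\<lambda>e. degree_in T e - 1) E)"
    using T by (auto simp: hypertree_def)
  then show ?thesis
    by blast
qed

lemma internal_inactivity_eq:
  "internal_inactivity V E \<epsilon> r f = card (inactive_set r E {f. hypertree V E \<epsilon> f} f)"
  unfolding internal_inactivity_def internally_inactive_def can_transfer_def inactive_set_def
  by (rule arg_cong[where f = card]) auto

text \<open>Coefficients count hypertrees, so no cancellation occurs and the support is the set of
  attained inactivities.\<close>

lemma coeff_interior_polynomial:
  assumes "bipartite_graph V E \<epsilon>"
  shows "coeff (interior_polynomial V E \<epsilon> r) i =
    int (card {f. hypertree V E \<epsilon> f \<and> internal_inactivity V E \<epsilon> r f = i})"
proof -
  have "coeff (interior_polynomial V E \<epsilon> r) i =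
      (\<Sum>f | hypertree V E \<epsilon> f. if internal_inactivity V E \<epsilon> r f = i then 1 else 0)"
    by (simp add: interior_polynomial_def coeff_sum)
  also have "\<dots> = int (card {f. hypertree V E \<epsilon> f \<and> internal_inactivity V E \<epsilon> r f = i})"
    using finite_hypertrees[OF assms] by (subst sum.inter_filter[symmetric]) auto
  finally show ?thesis .
qed

theorem theorem25:
  fixes V E :: "'a set" and \<epsilon> :: "'a set set" and r :: "'a rel"
  assumes "bipartite_graph V E \<epsilon>"
    and "connected_graph (V \<union> E) \<epsilon>"
    and "linear_order_on E r"
  shows "interpolating (interior_polynomial V E \<epsilon> r)"
proof -
  let ?H = "{f. hypertree V E \<epsilon> f}" and ?\<iota> = "internal_inactivity V E \<epsilon> r"
  have fin: "finite ?H" and "finite E" and ne: "?H \<noteq> {}"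
    using finite_hypertrees[OF assms(1)] assms(1) ex_hypertree[OF assms(1,2)]
    by (auto simp: bipartite_graph_def)
  have "finite {f. hypertree V E \<epsilon> f \<and> ?\<iota> f = i}" for i
    using fin by (rule rev_finite_subset) auto
  then have "{i. coeff (interior_polynomial V E \<epsilon> r) i \<noteq> 0} = ?\<iota> ` ?H"
    by (auto simp: coeff_interior_polynomial[OF assms(1)])
  also have "\<dots> = {0..Max (?\<iota> ` ?H)}"
  proof
    show "?\<iota> ` ?H \<subseteq> {0..Max (?\<iota> ` ?H)}"
      using fin by auto
    show "{0..Max (?\<iota> ` ?H)} \<subseteq> ?\<iota> ` ?H"
    proof
      fix k assume k: "k \<in> {0..Max (?\<iota> ` ?H)}"
      \<comment> \<open>The maximum is attained because a hypertree exists; downward closure then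
        supplies every smaller value.\<close>
      have "Max (?\<iota> ` ?H) \<in> ?\<iota> ` ?H"
        using fin ne by (intro Max_in) auto
      then obtain f where "f \<in> ?H" "k \<le> ?\<iota> f"
        using k by auto
      then show "k \<in> ?\<iota> ` ?H"
        using inactivities_downward_closed[OF \<open>finite E\<close> assms(3) order_refl
            exchange_on_hypertrees[OF assms(1)], of f k]
        by (auto simp: internal_inactivity_eq)
    qed
  qed
  finally show ?thesis
    unfolding interpolating_def by blast
qed

end
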